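(* Let $\{\phi,\psi\}\subset\mathbb{F}$ be two deterministic policies of a finite Markov decision process. Each of the following two conditions is necessary and sufficient for $v_\alpha^{\phi}=v_\alpha^{\psi}$ for all $\alpha\in[0,1)$: (a) $P^t(\phi)r(\phi)=P^t(\psi)r(\psi)$ for all $t\in\mathbb{N}$; (b) $P^t(\phi)r(\phi)=P^t(\psi)r(\psi)$ for all $t=0,1,\ldots,\min\{G(\phi,r(\phi)),G(\psi,r(\psi))\}-1$.
   Context: $\mathbb{N}=\{0,1,2,\ldots\}$ and $\mathbb{N}^+=\{1,2,\ldots\}$. A finite Markov decision process (MDP) has a finite state set $\mathbb{X}=\{x^1,\ldots,x^m\}$, a finite nonempty action set $A(x)$ for each $x\in\mathbb{X}$, real one-step rewards $r(x,a)$, and transition probabilities $p(\cdot|x,a)$ on $\mathbb{X}$ for $x\in\mathbb{X}$, $a\in A(x)$. $\mathbb{F}$ is the set of deterministic policies (decision rules), i.e. maps $\phi$ on $\mathbb{X}$ with $\phi(x)\in A(x)$. Functions on $\mathbb{X}$ are identified with column vectors in $\mathbb{R}^m$. For $\phi\in\mathbb{F}$, $P(\phi)$ is the $m\times m$ stochastic matrix with entries $P_{i,j}(\phi)=p(x^j|x^i,\phi(x^i))$, $P^t(\phi)$ is its $t$-th power ($P^0(\phi)=I$), and $r(\phi)\in\mathbb{R}^m$ is given by $r(\phi)(x)=r(x,\phi(x))$. For a discount factor $\alpha\in[0,1)$, $v_\alpha^\phi=\sum_{t=0}^\infty\alpha^tP^t(\phi)r(\phi)=[I-\alpha P(\phi)]^{-1}r(\phi)$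 is the vector of infinite-horizon expected total discounted rewards of $\phi$. Let $\mathbf{1}\in\mathbb{R}^m$ be the all-ones vector. For $\phi\in\mathbb{F}$ and $\mathbf{v}\in\mathbb{R}^m$, set $G(\phi,\mathbf{v}):=1$ if $\mathbf{v}=c\mathbf{1}$ for some $c\in\mathbb{R}$, and otherwise $G(\phi,\mathbf{v}):=\max\{t\in\mathbb{N}^+:\ \mathbf{1},P^0(\phi)\mathbf{v},P^1(\phi)\mathbf{v},\ldots,P^{t-2}(\phi)\mathbf{v}\text{ are linearly independent}\}$ (for $t=1$ the list consists of $\mathbf{1}$ only). *)

theory Defs
  imports "HOL-Analysis.Analysis"
begin

text \<open>
  The state space is the finite type \<open>'x\<close>, so \<open>m = CARD('x)\<close> is an arbitrary positive integer.
  Rewards and transition probabilities are total functions; only their values at pairs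
  \<open>(x, a)\<close> with \<open>a \<in> A x\<close> are constrained or used. The one-step rewards \<open>r\<close> are arbitrary reals.
\<close>

definition finite_mdp :: "('x::finite \<Rightarrow> 'a set) \<Rightarrow> ('x \<Rightarrow> 'a \<Rightarrow> 'x \<Rightarrow> real) \<Rightarrow> bool" where
  "finite_mdp A p \<longleftrightarrow>
     (\<forall>x. finite (A x) \<and> A x \<noteq> {}) \<and>
     (\<forall>x. \<forall>a\<in>A x. (\<forall>y. 0 \<le> p x a y) \<and> (\<Sum>y\<in>UNIV. p x a y) = 1)"

definition policies :: "('x \<Rightarrow> 'a set) \<Rightarrow> ('x \<Rightarrow> 'a) set" where
  "policies A = {\<phi>. \<forall>x. \<phi> x \<in> A x}"

definition trans_mat :: "('x::finite \<Rightarrow> 'a \<Rightarrow> 'x \<Rightarrow> real) \<Rightarrow> ('x \<Rightarrow> 'a) \<Rightarrow> real^'x^'x" where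
  "trans_mat p \<phi> = (\<chi> x y. p x (\<phi> x) y)"

definition reward_vec :: "('x::finite \<Rightarrow> 'a \<Rightarrow> real) \<Rightarrow> ('x \<Rightarrow> 'a) \<Rightarrow> real^'x" where
  "reward_vec r \<phi> = (\<chi> x. r x (\<phi> x))"

text \<open>The overloaded power on \<open>real^'x^'x\<close> is taken entrywise, so it cannot be used for \<open>P\<^sup>t(\<phi>)\<close>.\<close>

definition mat_pow :: "real^'x^'x \<Rightarrow> nat \<Rightarrow> real^'x^'x" where
  "mat_pow M t = (((**) M) ^^ t) (mat 1)"

definition discounted_value ::
  "('x::finite \<Rightarrow> 'a \<Rightarrow> real) \<Rightarrow> ('x \<Rightarrow> 'a \<Rightarrow> 'x \<Rightarrow> real) \<Rightarrow> real \<Rightarrow> ('x \<Rightarrow> 'a) \<Rightarrow> real^'x" where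
  "discounted_value r p \<alpha> \<phi> =
     (\<Sum>t. \<alpha> ^ t *\<^sub>R (mat_pow (trans_mat p \<phi>) t *v reward_vec r \<phi>))"

text \<open>
  Linear independence of a finite family. Distinctness is required because \<open>independent\<close> is a
  property of sets and does not see repeated vectors.
\<close>

definition lin_indep_list :: "(real^'x) list \<Rightarrow> bool" where
  "lin_indep_list vs \<longleftrightarrow> distinct vs \<and> independent (set vs)"

text \<open>
  The list \<open>1, P\<^sup>0 v, \<dots>, P\<^sup>t\<^sup>-\<^sup>2 v\<close> of length \<open>t \<ge> 1\<close>; the vector \<open>1 :: real^'x\<close> is the all-ones vector.
\<close>

definition krylov_list :: "real^'x^'x \<Rightarrow> real^'x \<Rightarrow> nat \<Rightarrow> (real^'x) list" where
  "krylov_list M v t = 1 # map (\<lambda>s. mat_pow M s *v v) [0..<t - 1]"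

definition G :: "('x::finite \<Rightarrow> 'a \<Rightarrow> 'x \<Rightarrow> real) \<Rightarrow> ('x \<Rightarrow> 'a) \<Rightarrow> real^'x \<Rightarrow> nat" where
  "G p \<phi> v =
     (if \<exists>c::real. v = c *\<^sub>R 1 then 1
      else Max {t. 1 \<le> t \<and> lin_indep_list (krylov_list (trans_mat p \<phi>) v t)})"

lemma lin_indep_list_iff:
  "lin_indep_list vs \<longleftrightarrow>
     (\<forall>c. (\<Sum>i<length vs. c i *\<^sub>R vs ! i) = 0 \<longrightarrow> (\<forall>i<length vs. c i = (0::real)))"
proof
  assume a: "lin_indep_list vs"
  then have d: "distinct vs" and ind: "independent (set vs)"
    by (auto simp: lin_indep_list_def)
  have bij: "bij_betw (\<lambda>i. vs ! i) {..<length vs} (set vs)"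
    using d by (simp add: bij_betw_nth)
  show "\<forall>c. (\<Sum>i<length vs. c i *\<^sub>R vs ! i) = 0 \<longrightarrow> (\<forall>i<length vs. c i = 0)"
  proof (intro allI impI)
    fix c :: "nat \<Rightarrow> real" and i
    assume 0: "(\<Sum>i<length vs. c i *\<^sub>R vs ! i) = 0" and i: "i < length vs"
    define u where "u = (\<lambda>x. c (the_inv_into {..<length vs} (\<lambda>i. vs ! i) x))"
    have u: "u (vs ! j) = c j" if "j < length vs" for j
      unfolding u_def using bij that by (simp add: the_inv_into_f_f bij_betw_def)
    have "(\<Sum>x\<in>set vs. u x *\<^sub>R x) = (\<Sum>i<length vs. u (vs ! i) *\<^sub>R vs ! i)"
      using sum.reindex_bij_betw[OF bij, of "\<lambda>x. u x *\<^sub>R x"] by simp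
    also have "\<dots> = 0" using 0 u by simp
    finally have "u (vs ! i) = 0"
      using ind i by (auto simp: independent_explicit_finite_subsets
          dest: spec[of _ "set vs"] intro: nth_mem)
    then show "c i = 0" using u i by simp
  qed
next
  assume a: "\<forall>c. (\<Sum>i<length vs. c i *\<^sub>R vs ! i) = 0 \<longrightarrow> (\<forall>i<length vs. c i = (0::real))"
  have d: "distinct vs"
  proof (rule ccontr)
    assume "\<not> distinct vs"
    then obtain i j where ij: "i < length vs" "j < length vs" "i \<noteq> j" "vs ! i = vs ! j"
      by (auto simp: distinct_conv_nth)
    define c where "c = (\<lambda>k. if k = i then 1 else if k = j then -1 else (0::real))"
    have "(\<Sum>k<length vs. c k *\<^sub>R vs ! k) = (\<Sum>k\<in>{i,j}. c k *\<^sub>R vs ! k)"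
      using ij by (intro sum.mono_neutral_right) (auto simp: c_def)
    also have "\<dots> = 0" using ij by (simp add: c_def)
    finally have "c i = 0" using a ij by blast
    then show False by (simp add: c_def)
  qed
  have bij: "bij_betw (\<lambda>i. vs ! i) {..<length vs} (set vs)"
    using d by (simp add: bij_betw_nth)
  have "independent (set vs)"
  proof (rule independent_if_scalars_zero)
    fix f x assume 0: "(\<Sum>x\<in>set vs. f x *\<^sub>R x) = 0" and x: "x \<in> set vs"
    then obtain i where i: "i < length vs" "x = vs ! i" by (auto simp: in_set_conv_nth)
    have "(\<Sum>i<length vs. f (vs ! i) *\<^sub>R vs ! i) = 0"
      using sum.reindex_bij_betw[OF bij, of "\<lambda>x. f x *\<^sub>R x"] 0 by simp
    then show "f x = 0" using spec[OF a, of "\<lambda>i. f (vs ! i)"] i by blast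
  qed simp
  with d show "lin_indep_list vs" by (simp add: lin_indep_list_def)
qed

text \<open>The maximum in the definition of \<open>G\<close> is taken over a finite nonempty set.\<close>

lemma G_set_finite_nonempty:
  fixes M :: "real^'x^'x" and v :: "real^'x"
  defines "T \<equiv> {t. 1 \<le> t \<and> lin_indep_list (krylov_list M v t)}"
  shows "finite T" and "T \<noteq> {}"
proof -
  have "t \<le> CARD('x)" if "t \<in> T" for t
  proof -
    let ?l = "krylov_list M v t"
    have "1 \<le> t" and d: "distinct ?l" and i: "independent (set ?l)"
      using that by (auto simp: T_def lin_indep_list_def)
    then have "t = length ?l" by (simp add: krylov_list_def)
    also have "\<dots> = card (set ?l)" using d by (simp add: distinct_card)
    also have "\<dots> \<le> DIM(real^'x)" using independent_bound[OF i] by blast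
    finally show ?thesis by simp
  qed
  then show "finite T" by (meson atMost_iff finite_atMost finite_subset subsetI)
  have "(1::real^'x) \<noteq> 0" by (simp add: vec_eq_iff)
  then have "1 \<in> T" by (simp add: T_def lin_indep_list_def krylov_list_def)
  then show "T \<noteq> {}" by blast
qed

lemma mat_pow_trans_mat_nonneg_rows:
  assumes "finite_mdp A p" "\<phi> \<in> policies A"
  shows "(\<forall>x y. 0 \<le> mat_pow (trans_mat p \<phi>) t $ x $ y) \<and>
         (\<forall>x. (\<Sum>y\<in>UNIV. mat_pow (trans_mat p \<phi>) t $ x $ y) = 1)"
proof (induction t)
  case 0
  show ?case by (simp add: mat_pow_def mat_def)
next
  case (Suc t)
  let ?P = "trans_mat p \<phi>"
  have P: "0 \<le> ?P $ x $ y" "(\<Sum>y\<in>UNIV. ?P $ x $ y) = 1" for x y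
    using assms by (auto simp: finite_mdp_def policies_def trans_mat_def)
  have S: "mat_pow ?P (Suc t) $ x $ y = (\<Sum>z\<in>UNIV. ?P $ x $ z * mat_pow ?P t $ z $ y)" for x y
    by (simp add: mat_pow_def matrix_matrix_mult_def)
  have "(\<Sum>y\<in>UNIV. mat_pow ?P (Suc t) $ x $ y) = 1" for x
  proof -
    have "(\<Sum>y\<in>UNIV. mat_pow ?P (Suc t) $ x $ y)
        = (\<Sum>z\<in>UNIV. \<Sum>y\<in>UNIV. ?P $ x $ z * mat_pow ?P t $ z $ y)"
      unfolding S by (rule sum.swap)
    also have "\<dots> = (\<Sum>z\<in>UNIV. ?P $ x $ z * (\<Sum>y\<in>UNIV. mat_pow ?P t $ z $ y))"
      by (simp add: sum_distrib_left)
    finally show ?thesis using Suc P by simp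
  qed
  with Suc P show ?case by (auto simp: S intro!: sum_nonneg)
qed

text \<open>The series defining \<open>discounted_value\<close> converges, and its sum is \<open>[I - \<alpha> P(\<phi>)]\<^sup>-\<^sup>1 r(\<phi>)\<close>.\<close>

lemma discounted_value_summable:
  assumes mdp: "finite_mdp A p" "\<phi> \<in> policies A" and \<alpha>: "\<alpha> \<in> {0..<1}"
  shows "summable (\<lambda>t. \<alpha> ^ t *\<^sub>R (mat_pow (trans_mat p \<phi>) t *v w))"
proof (rule summable_comparison_test)
  let ?P = "trans_mat p \<phi>"
  let ?C = "\<Sum>x\<in>(UNIV::'a set). \<Sum>y\<in>UNIV. \<bar>w $ y\<bar>"
  note st = mat_pow_trans_mat_nonneg_rows[OF mdp]
  have le1: "mat_pow ?P t $ x $ y \<le> 1" for t x y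
    using st[of t] member_le_sum[of y UNIV "\<lambda>y. mat_pow ?P t $ x $ y"] by simp
  have "norm (mat_pow ?P t *v w) \<le> ?C" for t
  proof -
    have "norm (mat_pow ?P t *v w) \<le> (\<Sum>x\<in>UNIV. \<bar>(mat_pow ?P t *v w) $ x\<bar>)"
      by (rule norm_le_l1_cart)
    also have "\<dots> \<le> (\<Sum>x\<in>UNIV. \<Sum>y\<in>UNIV. \<bar>mat_pow ?P t $ x $ y * w $ y\<bar>)"
      by (intro sum_mono) (simp add: matrix_vector_mult_def)
    also have "\<dots> \<le> ?C"
      using st le1 by (intro sum_mono) (simp add: abs_mult mult_left_le_one_le)
    finally show ?thesis .
  qed
  then show "\<exists>N. \<forall>t\<ge>N. norm (\<alpha> ^ t *\<^sub>R (mat_pow ?P t *v w)) \<le> \<alpha> ^ t * ?C"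
    using \<alpha> by (intro exI[of _ 0]) (simp add: mult_left_mono)
  show "summable (\<lambda>t. \<alpha> ^ t * ?C)"
    using \<alpha> by (intro summable_mult2 summable_geometric) simp
qed

lemma discounted_value_eq_inverse:
  assumes mdp: "finite_mdp A p" "\<phi> \<in> policies A" and \<alpha>: "\<alpha> \<in> {0..<1}"
  shows "invertible (mat 1 - \<alpha> *\<^sub>R trans_mat p \<phi>)"
    and "discounted_value r p \<alpha> \<phi> =
           matrix_inv (mat 1 - \<alpha> *\<^sub>R trans_mat p \<phi>) *v reward_vec r \<phi>"
proof -
  let ?P = "trans_mat p \<phi>"
  let ?M = "mat 1 - \<alpha> *\<^sub>R ?P"
  define V where "V w = (\<Sum>t. \<alpha> ^ t *\<^sub>R (mat_pow ?P t *v w))" for w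
  have MV: "?M *v V w = w" for w
  proof -
    let ?f = "\<lambda>t. \<alpha> ^ t *\<^sub>R (mat_pow ?P t *v w)"
    have s: "summable ?f" by (rule discounted_value_summable[OF mdp \<alpha>])
    have bl: "bounded_linear ((*v) (\<alpha> *\<^sub>R ?P))"
      by (simp add: linear_conv_bounded_linear[symmetric])
    have step: "(\<alpha> *\<^sub>R ?P) *v ?f t = ?f (Suc t)" for t
      by (simp add: mat_pow_def matrix_vector_mul_assoc[symmetric]
          scaleR_matrix_vector_assoc[symmetric] matrix_vector_mult_scaleR)
    have "(\<alpha> *\<^sub>R ?P) *v V w = (\<Sum>t. (\<alpha> *\<^sub>R ?P) *v ?f t)"
      unfolding V_def by (rule bounded_linear.suminf[OF bl s])
    also have "\<dots> = (\<Sum>t. ?f (Suc t))" by (simp only: step)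
    also have "\<dots> = V w - ?f 0" unfolding V_def by (rule suminf_split_head[OF s])
    finally show ?thesis
      by (simp add: matrix_vector_mult_diff_rdistrib mat_pow_def)
  qed
  have "surj ((*v) ?M)" using MV by (metis surjI)
  then obtain B where B: "?M ** B = mat 1"
    using matrix_right_invertible_surjective by blast
  then have B': "B ** ?M = mat 1" by (simp add: matrix_left_right_inverse)
  with B show inv: "invertible ?M" unfolding invertible_def by blast
  have Minv: "matrix_inv ?M ** ?M = mat 1"
    unfolding matrix_inv_def using someI_ex[OF inv[unfolded invertible_def]] by blast
  have "matrix_inv ?M *v (?M *v V w) = V w" for w
    by (simp only: matrix_vector_mul_assoc Minv matrix_vector_mul_lid)
  then have "V (reward_vec r \<phi>) = matrix_inv ?M *v reward_vec r \<phi>"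
    by (simp only: MV)
  then show "discounted_value r p \<alpha> \<phi> = matrix_inv ?M *v reward_vec r \<phi>"
    by (simp only: V_def discounted_value_def)
qed

end

theory Submission
  imports Defs "HOL-Complex_Analysis.Cauchy_Integral_Formula"
begin

text \<open>
  A power series that vanishes on \<open>[0, 1)\<close> has only zero coefficients, which settles (a).
  For (b), let \<open>P\<close>, \<open>Q\<close> be the two transition matrices, with \<open>P\<close> the one whose \<open>G\<close> is smaller, let
  \<open>u\<^sub>t\<close> be the vectors \<open>P\<^sup>t r\<close> for that policy, and let \<open>n = G - 1\<close>. By maximality of \<open>G\<close> the vector
  \<open>u\<^sub>n\<close> lies in the span \<open>W\<close> of \<open>1, u\<^sub>0, \<dots>, u\<^sub>n\<^sub>-\<^sub>1\<close>, so \<open>W\<close> is \<open>P\<close>-invariant and contains every \<open>u\<^sub>t\<close>.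
  Agreement up to time \<open>n\<close> says that \<open>P\<close> and \<open>Q\<close> coincide on the generators of \<open>W\<close> (both fix \<open>1\<close>,
  being stochastic), hence on \<open>W\<close>, and so the two sequences never separate.
\<close>

text \<open>A nonzero power series that vanishes at 0 has an isolated zero there, whereas here the
  zeros accumulate at 0 from the right.\<close>

lemma powser_eq_0_imp_coeffs_eq_0:
  fixes d :: "nat \<Rightarrow> real"
  assumes sums: "\<And>x. x \<in> {0..<1} \<Longrightarrow> (\<lambda>n. d n * x ^ n) sums 0"
  shows "d m = 0"
proof (rule ccontr)
  assume m: "d m \<noteq> 0"
  have d0: "d 0 = 0"
    using sums[of 0] powser_sums_zero[of d] by (auto dest: sums_unique2)
  then have "0 < m" using m by (cases m) auto
  define f where "f x = (\<Sum>n. d n * x ^ n)" for x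
  \<comment> \<open>Negative \<open>x\<close> lies outside the hypothesis; convergence at the point
    1/2 gives it on the whole disc of that radius.\<close>
  have f: "(\<lambda>n. d n * x ^ n) sums f x" if "norm x < 1 / 2" for x
  proof -
    have "summable (\<lambda>n. d n * (1 / 2) ^ n)"
      by (rule sums_summable[OF sums]) simp
    from powser_inside[OF this, of x] that show ?thesis
      by (simp add: f_def summable_sums)
  qed
  have "f 0 = 0" using d0 by (simp add: f_def)
  then obtain s where s: "0 < s" "\<And>z. z \<in> cball 0 s - {0} \<Longrightarrow> f z \<noteq> 0"
    using powser_0_nonzero[where r = "1 / 2" and a = d and f = f and \<xi> = 0 and m = m] f m \<open>0 < m\<close> by auto
  \<comment> \<open>A positive point lying both in the punctured ball and in [0, 1).\<close>
  let ?z = "min s (1 / 4)"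
  have "f ?z = 0"
    unfolding f_def using s(1) by (intro sums_unique[symmetric] sums) auto
  then show False using s(1) s(2)[of ?z] by auto
qed

lemma vec_powser_eq_imp_coeffs_eq:
  fixes u w :: "nat \<Rightarrow> real^'n"
  assumes summable: "\<And>\<alpha>. \<alpha> \<in> {0..<1} \<Longrightarrow> summable (\<lambda>t. \<alpha> ^ t *\<^sub>R u t)"
      "\<And>\<alpha>. \<alpha> \<in> {0..<1} \<Longrightarrow> summable (\<lambda>t. \<alpha> ^ t *\<^sub>R w t)"
    and eq: "\<And>\<alpha>. \<alpha> \<in> {0..<1} \<Longrightarrow> (\<Sum>t. \<alpha> ^ t *\<^sub>R u t) = (\<Sum>t. \<alpha> ^ t *\<^sub>R w t)"
  shows "u t = w t"
proof (rule vec_eq_iff[THEN iffD2], rule allI)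
  fix i
  have "(\<lambda>n. (u n - w n) $ i * \<alpha> ^ n) sums 0" if \<alpha>: "\<alpha> \<in> {0..<1}" for \<alpha>
  proof -
    have "(\<lambda>t. \<alpha> ^ t *\<^sub>R u t - \<alpha> ^ t *\<^sub>R w t) sums 0"
      using sums_diff[OF summable_sums[OF summable(1)[OF \<alpha>]] summable_sums[OF summable(2)[OF \<alpha>]]]
        eq[OF \<alpha>] by simp
    from bounded_linear.sums[OF bounded_linear_vec_nth this, of i] show ?thesis
      by (simp add: algebra_simps)
  qed
  from powser_eq_0_imp_coeffs_eq_0[OF this, of t] show "u t $ i = w t $ i" by simp
qed

lemma mat_pow_Suc_mult: "mat_pow M (Suc t) *v v = M *v (mat_pow M t *v v)"
  by (simp add: mat_pow_def matrix_vector_mul_assoc)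

lemma mat_pow_0_mult: "mat_pow M 0 *v v = v"
  by (simp add: mat_pow_def)

lemma krylov_list_Suc:
  "krylov_list M v (Suc (Suc n)) = krylov_list M v (Suc n) @ [mat_pow M n *v v]"
  by (simp add: krylov_list_def)

lemma set_krylov_list:
  "set (krylov_list M v (Suc n)) = insert 1 ((\<lambda>s. mat_pow M s *v v) ` {..<n})"
  by (auto simp: krylov_list_def)

lemma lin_indep_list_snoc:
  "lin_indep_list (vs @ [x]) \<longleftrightarrow> lin_indep_list vs \<and> x \<notin> span (set vs)"
  by (auto simp: lin_indep_list_def independent_insert span_base)

lemma mat_pow_in_span_at_G:
  fixes p :: "'x::finite \<Rightarrow> 'a \<Rightarrow> 'x \<Rightarrow> real" and \<phi> and v :: "real^'x"
  defines "n \<equiv> G p \<phi> v - 1"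
  shows "mat_pow (trans_mat p \<phi>) n *v v
    \<in> span (insert 1 ((\<lambda>s. mat_pow (trans_mat p \<phi>) s *v v) ` {..<n}))"
proof (cases "\<exists>c::real. v = c *\<^sub>R 1")
  case True
  \<comment> \<open>By the convention for multiples of \<open>1\<close>, the claim reduces to
    \<open>v\<close> lying in the span of \<open>1\<close>.\<close>
  then have "n = 0" by (simp add: n_def G_def)
  then show ?thesis using True by (auto simp: mat_pow_0_mult intro: span_scale span_base)
next
  case False
  let ?l = "krylov_list (trans_mat p \<phi>) v"
  let ?T = "{t. 1 \<le> t \<and> lin_indep_list (?l t)}"
  note T = G_set_finite_nonempty[of "trans_mat p \<phi>" v]
  have G: "G p \<phi> v = Max ?T" using False by (simp add: G_def)
  then have "G p \<phi> v \<in> ?T" using Max_in[OF T] by simp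
  then have l: "lin_indep_list (?l (Suc n))" and Gn: "G p \<phi> v = Suc n"
    by (auto simp: n_def)
  \<comment> \<open>The list of length \<open>n + 2\<close> is the first to contain the
    \<open>n\<close>-th iterate, so its dependence puts that iterate in the span of the earlier
    entries.\<close>
  have "Suc (Suc n) \<notin> ?T"
    using Max_ge[OF T(1), of "Suc (Suc n)"] G Gn by auto
  then have "\<not> lin_indep_list (?l (Suc (Suc n)))" by simp
  then show ?thesis
    using l by (simp add: krylov_list_Suc lin_indep_list_snoc set_krylov_list)
qed

lemma trans_mat_mult_1:
  assumes "finite_mdp A p" "\<phi> \<in> policies A"
  shows "trans_mat p \<phi> *v 1 = 1"
  using assms
  by (auto simp: vec_eq_iff matrix_vector_mult_def trans_mat_def finite_mdp_def policies_def)

lemma mat_pow_mult_eq_if_eq_upto: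
  fixes P Q :: "real^'x^'x" and v w :: "real^'x"
  assumes one: "P *v 1 = 1" "Q *v 1 = 1"
    and span: "mat_pow P n *v v \<in> span (insert 1 ((\<lambda>s. mat_pow P s *v v) ` {..<n}))"
    and eq: "\<And>t. t \<le> n \<Longrightarrow> mat_pow P t *v v = mat_pow Q t *v w"
  shows "mat_pow P t *v v = mat_pow Q t *v w"
proof -
  define W where "W = span (insert 1 ((\<lambda>s. mat_pow P s *v v) ` {..<n}))"
  have base: "mat_pow P s *v v \<in> W" if "s \<le> n" for s
    using that span by (cases "s = n") (auto simp: W_def intro: span_base)
  have "1 \<in> W" by (simp add: W_def span_base)
  have inv: "P *v x \<in> W" and agree: "P *v x = Q *v x" if "x \<in> W" for x
  proof -
    have "subspace W" by (simp add: W_def)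
    have gen: "P *v y \<in> W \<and> P *v y = Q *v y"
      if y: "y \<in> insert 1 ((\<lambda>s. mat_pow P s *v v) ` {..<n})" for y
    proof (cases "y = 1")
      case True
      then show ?thesis using one \<open>1 \<in> W\<close> by simp
    next
      case False
      then obtain s where s: "s < n" "y = mat_pow P s *v v" using y by auto
      \<comment> \<open>Both matrices shift the index by one, so a generator with
        \<open>s < n\<close> needs agreement at \<open>Suc s\<close>, which can equal
        \<open>n\<close>; there \<open>base\<close> relies on the span hypothesis.\<close>
      then show ?thesis
        using base[of "Suc s"] eq[of "Suc s"] eq[of s] by (simp add: mat_pow_Suc_mult)
    qed
    have "P *v x \<in> W \<and> P *v x = Q *v x"
      using that[unfolded W_def]
    proof (induction rule: span_induct_alt)
      case base
      show ?case using \<open>subspace W\<close> by (simp add: subspace_0)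
    next
      case (step c y z)
      then have "c *\<^sub>R (P *v y) + P *v z \<in> W"
        using gen[of y] \<open>subspace W\<close> by (blast intro: subspace_add subspace_scale)
      moreover have "P *v y = Q *v y" "P *v z = Q *v z"
        using gen[of y] step by auto
      ultimately show ?case
        by (simp add: matrix_vector_right_distrib matrix_vector_mult_scaleR)
    qed
    then show "P *v x \<in> W" "P *v x = Q *v x" by auto
  qed
  have "mat_pow P t *v v \<in> W \<and> mat_pow P t *v v = mat_pow Q t *v w"
  proof (induction t)
    case 0
    show ?case using base[of 0] eq[of 0] by simp
  next
    case (Suc t)
    \<comment> \<open>On \<open>W\<close> the matrix \<open>P\<close> may be replaced by
      \<open>Q\<close>, and the induction hypothesis then turns the \<open>v\<close>-iterate into
      the \<open>w\<close>-iterate.\<close>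
    then show ?case using inv agree by (metis mat_pow_Suc_mult)
  qed
  then show ?thesis ..
qed

theorem theorem2p1:
  fixes A :: "'x::finite \<Rightarrow> 'a set"
    and r :: "'x \<Rightarrow> 'a \<Rightarrow> real"
    and p :: "'x \<Rightarrow> 'a \<Rightarrow> 'x \<Rightarrow> real"
    and \<phi> \<psi> :: "'x \<Rightarrow> 'a"
  assumes "finite_mdp A p"
    and "{\<phi>, \<psi>} \<subseteq> policies A"
  shows "((\<forall>\<alpha>\<in>{0..<1}. discounted_value r p \<alpha> \<phi> = discounted_value r p \<alpha> \<psi>) \<longleftrightarrow>
          (\<forall>t. mat_pow (trans_mat p \<phi>) t *v reward_vec r \<phi> =
               mat_pow (trans_mat p \<psi>) t *v reward_vec r \<psi>)) \<and>
         ((\<forall>\<alpha>\<in>{0..<1}. discounted_value r p \<alpha> \<phi> = discounted_value r p \<alpha> \<psi>) \<longleftrightarrow>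
          (\<forall>t\<in>{0..min (G p \<phi> (reward_vec r \<phi>)) (G p \<psi> (reward_vec r \<psi>)) - 1}.
               mat_pow (trans_mat p \<phi>) t *v reward_vec r \<phi> =
               mat_pow (trans_mat p \<psi>) t *v reward_vec r \<psi>))"
proof -
  let ?u = "\<lambda>t. mat_pow (trans_mat p \<phi>) t *v reward_vec r \<phi>"
  let ?w = "\<lambda>t. mat_pow (trans_mat p \<psi>) t *v reward_vec r \<psi>"
  let ?D = "\<forall>\<alpha>\<in>{0..<1}. discounted_value r p \<alpha> \<phi> = discounted_value r p \<alpha> \<psi>"
  let ?g = "G p \<phi> (reward_vec r \<phi>)" and ?h = "G p \<psi> (reward_vec r \<psi>)"
  have \<phi>: "\<phi> \<in> policies A" and \<psi>: "\<psi> \<in> policies A" using assms(2) by auto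
  note one = trans_mat_mult_1[OF assms(1) \<phi>] trans_mat_mult_1[OF assms(1) \<psi>]
  have a: "?D \<longleftrightarrow> (\<forall>t. ?u t = ?w t)"
  proof
    assume ?D
    then show "\<forall>t. ?u t = ?w t"
      using vec_powser_eq_imp_coeffs_eq[of ?u ?w]
        discounted_value_summable[OF assms(1) \<phi>] discounted_value_summable[OF assms(1) \<psi>]
      by (simp add: discounted_value_def)
  qed (simp add: discounted_value_def)
  have b: "?u t = ?w t" if eq: "\<forall>t\<in>{0..min ?g ?h - 1}. ?u t = ?w t" for t
  proof (cases "?g \<le> ?h")
    case True
    then have "?u t = ?w t" if "t \<le> ?g - 1" for t
      using eq that by (simp add: min_def)
    then show ?thesis
      by (rule mat_pow_mult_eq_if_eq_upto[OF one mat_pow_in_span_at_G])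
  next
    case False
    \<comment> \<open>The span must come from the policy with the smaller \<open>G\<close>, so the
      two policies swap roles.\<close>
    then have "?w t = ?u t" if "t \<le> ?h - 1" for t
      using eq that by (simp add: min_def)
    then have "?w t = ?u t"
      by (rule mat_pow_mult_eq_if_eq_upto[OF one(2,1) mat_pow_in_span_at_G])
    then show ?thesis by simp
  qed
  from a b show ?thesis by blast
qed

end
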